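(* Let $N,n\ge 1$ be integers, let $A_i\in\mathbf{R}^{n\times n}$ and $\tau_i>0$, $i\in\mathbf{I}[1,N]$. The integral delay system $$x(t)=\sum_{i=1}^{N}A_i\int_{-\tau_i}^{0}x(t+s)\,\mathrm{d}s$$ is exponentially stable if $$\rho\Big(\sum_{i=1}^{N}\tau_i^{2}A_i\otimes A_i\Big)<\frac1N .$$ In particular, if $N=1$, the integral delay system is exponentially stable if $\rho(A_1)<\frac{1}{\tau_1}$.
   Context: Notation: $\mathbf{I}[1,N]=\{1,2,\ldots,N\}$; $\rho(A)$ is the spectral radius of a square matrix $A$; $\otimes$ is the Kronecker product. Let $\tau=\max_{i\in\mathbf{I}[1,N]}\tau_i$ and let $\mathscr{C}_{n,\tau}$ be the Banach space of continuous functions from $[-\tau,0]$ to $\mathbf{R}^n$ with the topology of uniform convergence. For an initial condition $\varphi\in\mathscr{C}_{n,\tau}$, the solution $x(t)=x(t,\varphi)$ satisfies $x(t)=\varphi(t)$ for $t\in[-\tau,0)$ and the integral delay system for all $t\ge 0$. The system is exponentially stable if there exist positive constants $\alpha,\beta$ (independent of $\varphi$) such that $\|x(t)\|\le\alpha\sup_{s\in[-\tau,0)}\|\varphi(s)\|\,\mathrm{e}^{-\beta t}$ for all $t\ge0$ and all initial conditions $\varphi$. *)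

theory Defs
  imports "HOL-Analysis.Analysis"
begin

definition kronecker :: "real^'b^'a \<Rightarrow> real^'d^'c \<Rightarrow> real^('b \<times> 'd)^('a \<times> 'c)"
    (infixl "\<otimes>\<^sub>K" 70) where
  "A \<otimes>\<^sub>K B = (\<chi> i j. A $ fst i $ fst j * B $ snd i $ snd j)"

text \<open>Eigenvalues of a real matrix are complex: they are taken over the complexification.\<close>

definition complex_spectrum :: "real^'n^'n \<Rightarrow> complex set" where
  "complex_spectrum A =
     {k. \<exists>v :: complex^'n. v \<noteq> 0 \<and> map_matrix complex_of_real A *v v = k *s v}"

definition mat_spectral_radius :: "real^'n^'n \<Rightarrow> real" where
  "mat_spectral_radius A = Max (cmod ` complex_spectrum A)"

definition max_delay :: "nat \<Rightarrow> (nat \<Rightarrow> real) \<Rightarrow> real" where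
  "max_delay N \<tau> = Max (\<tau> ` {1..N})"

text \<open>Only the values of \<open>x\<close> on \<open>[-max_delay N \<tau>, \<infinity>)\<close> matter. The initial condition
  is imposed on the half-open interval, so \<open>x\<close> may jump at \<open>0\<close>. Integrability is required
  because \<^const>\<open>integral\<close> is \<open>0\<close> on non-integrable functions; together with the
  equation it forces \<open>x\<close> to be continuous on \<open>[0, \<infinity>)\<close>.\<close>

definition ids_solution ::
    "nat \<Rightarrow> (nat \<Rightarrow> real^'n^'n) \<Rightarrow> (nat \<Rightarrow> real) \<Rightarrow> (real \<Rightarrow> real^'n) \<Rightarrow> (real \<Rightarrow> real^'n) \<Rightarrow> bool" where
  "ids_solution N A \<tau> \<phi> x \<longleftrightarrow>
     (\<forall>t\<in>{- max_delay N \<tau>..<0}. x t = \<phi> t) \<and>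
     (\<forall>t\<ge>0. (\<forall>i\<in>{1..N}. (\<lambda>s. x (t + s)) integrable_on {- \<tau> i..0}) \<and>
             x t = (\<Sum>i=1..N. A i *v integral {- \<tau> i..0} (\<lambda>s. x (t + s))))"

definition ids_exponentially_stable ::
    "nat \<Rightarrow> (nat \<Rightarrow> real^'n^'n) \<Rightarrow> (nat \<Rightarrow> real) \<Rightarrow> bool" where
  "ids_exponentially_stable N A \<tau> \<longleftrightarrow>
     (\<exists>\<alpha>>0. \<exists>\<beta>>0. \<forall>\<phi> x.
        continuous_on {- max_delay N \<tau>..0} \<phi> \<longrightarrow> ids_solution N A \<tau> \<phi> x \<longrightarrow>
        (\<forall>t\<ge>0. norm (x t) \<le> \<alpha> * (SUP s\<in>{- max_delay N \<tau>..<0}. norm (\<phi> s)) * exp (- \<beta> * t)))"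

end

theory Submission
  imports Defs "HOL-Computational_Algebra.Fundamental_Theorem_Algebra"
begin

text \<open>
  The argument is a Lyapunov argument in integral form. Suppose that there is a bilinear form \<open>b\<close> with
  \<open>x \<bullet> x \<le> b x x\<close> and
  \<open>(\<Sum>i. N * (\<tau> i)\<^sup>2 * b (A i *v x) (A i *v x)) = b x x - x \<bullet> x\<close>. Since \<open>b\<close> is bounded, the right-hand
  side is at most \<open>(1 - \<delta>) * b x x\<close> for some \<open>\<delta> > 0\<close>. Applying the Cauchy-Schwarz (Jensen) inequality
  first to the sum over the \<open>N\<close> delays and then to each integral over a window of length \<open>\<tau> i\<close> gives,
  for a solution \<open>x\<close>, a bound of \<open>b (x t) (x t)\<close> by the sum over \<open>i\<close> of the averages of
  \<open>N * (\<tau> i)\<^sup>2 * b (A i *v x u) (A i *v x u)\<close> over the window \<open>[t - \<tau> i, t]\<close>. This is no pointwise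
  contraction, because the maxima over the windows may be attained at different times for different \<open>i\<close>.
  It becomes a contraction after integration over \<open>t\<close>: averaging over a
  sliding window does not increase the integral of a nonnegative function. This survives
  multiplication with the weight \<open>exp (2 * \<beta> * t)\<close> for small \<open>\<beta> > 0\<close>, whence the weighted integral of
  \<open>b (x t) (x t)\<close> over all of time is at most a constant multiple of the squared norm of the initial function. Using the window
  inequality once more turns this into the pointwise exponential bound
  (\<open>ids_exponentially_stable_of_lyapunov_form\<close>).

  The form \<open>b\<close> is the sum of the series that starts with the inner product and whose every further term is
  obtained from the previous one by the map
  \<open>g \<mapsto> (\<lambda>x y. \<Sum>i. N * (\<tau> i)\<^sup>2 * g (A i *v x) (A i *v y))\<close> (\<open>ex_lyapunov_form\<close>). The \<open>k\<close>-th term is a linear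
  functional of the \<open>k\<close>-th power of \<open>N\<close> times the matrix
  \<open>\<Sum>i. (\<tau> i)\<^sup>2 *\<^sub>R (A i \<otimes>\<^sub>K A i)\<close>, applied to the Kronecker product of \<open>x\<close> and \<open>y\<close>; so the
  series converges if that multiple has spectral radius less than one. For a single delay the \<open>k\<close>-th term is the inner product of the
  \<open>k\<close>-th iterates of \<open>x\<close> and \<open>y\<close> under \<open>\<tau> 1 *\<^sub>R A 1\<close>, so the
  spectral radius of \<open>A 1\<close> decides directly, without a detour through the spectrum of a Kronecker
  square.

  That the orbits of a matrix with spectral radius less than one are summable
  (\<open>summable_orbit\<close>) is derived from an annihilating polynomial, factor by factor.
\<close>

section \<open>Summable orbits of matrices with small spectral radius\<close>

text \<open>
  Otherwise the first \<open>k\<close> terms would be independent for every \<open>k\<close>.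
\<close>

lemma ex_in_span_of_predecessors:
  fixes f :: "nat \<Rightarrow> 'a::euclidean_space"
  shows "\<exists>k. f k \<in> span (f ` {..<k})"
proof (rule ccontr)
  assume "\<not> ?thesis"
  then have new: "f k \<notin> span (f ` {..<k})" for k by blast
  have "independent (f ` {..<k}) \<and> card (f ` {..<k}) = k" for k
  proof (induction k)
    case (Suc k)
    have nin: "f k \<notin> f ` {..<k}" using new[of k] span_base[of "f k" "f ` {..<k}"] by metis
    have "independent (insert (f k) (f ` {..<k}))"
      using Suc.IH new[of k] nin independent_insert[of "f k" "f ` {..<k}"] by simp
    with Suc.IH nin show ?case
      by (simp add: lessThan_Suc)
  qed (simp add: independent_empty)
  from this[of "Suc DIM('a)"] show False
    using independent_bound[of "f ` {..<Suc DIM('a)}"] by linarith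
qed

text \<open>
  The value of the polynomial \<open>p\<close> at the matrix \<open>M\<close>, by the Horner scheme: folding over the
  coefficients gives the recursion \<open>matpoly_pCons\<close> and hence proofs by induction on the polynomial.
\<close>

definition matpoly :: "complex^'n^'n \<Rightarrow> complex poly \<Rightarrow> complex^'n^'n" where
  "matpoly M p = fold_coeffs (\<lambda>a B. mat a + M ** B) p 0"

lemma mat_mult_vec: "mat c *v (v::complex^'n) = c *s v"
  by (simp add: vec_eq_iff matrix_vector_mult_def mat_def mult_delta_left)

lemma mat_mult_commute: "mat c ** B = B ** (mat c :: complex^'n^'n)"
  by (simp add: vec_eq_iff matrix_matrix_mult_def mat_def mult_delta_left mult_delta_right mult.commute)

lemma matrix_add_rdistrib: "(A + B) ** C = A ** C + B ** (C :: complex^'n^'n)"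
  by (simp add: vec_eq_iff matrix_matrix_mult_def sum.distrib algebra_simps)

lemma matpoly_0 [simp]: "matpoly M 0 = 0"
  by (simp add: matpoly_def)

lemma mat_0: "mat 0 = (0 :: complex^'n^'n)"
  by (simp add: vec_eq_iff mat_def)

lemma mat_add: "mat (a + b) = mat a + (mat b :: complex^'n^'n)"
  by (simp add: vec_eq_iff mat_def)

lemma mat_mult: "mat (a * b) = mat a ** (mat b :: complex^'n^'n)"
  by (simp add: vec_eq_iff matrix_matrix_mult_def mat_def mult_delta_left)

lemma matpoly_pCons: "matpoly M (pCons a p) = mat a + M ** matpoly M p"
  by (cases "p = 0 \<and> a = 0") (auto simp: matpoly_def mat_0)

lemma matpoly_add: "matpoly M (p + q) = matpoly M p + matpoly M q"
  by (induction p q rule: poly_induct2)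
    (simp_all add: matpoly_pCons mat_add matrix_add_ldistrib algebra_simps)

lemma matpoly_smult: "matpoly M (smult c p) = mat c ** matpoly M p"
proof (induction p)
  case (pCons a p)
  have "M ** (mat c ** matpoly M p) = mat c ** (M ** matpoly M p)"
    by (metis mat_mult_commute matrix_mul_assoc)
  with pCons show ?case
    by (simp add: matpoly_pCons mat_mult matrix_add_ldistrib)
qed (simp add: matrix_matrix_mult_def vec_eq_iff)

lemma matpoly_commute: "M ** matpoly M p = matpoly M p ** M"
proof (induction p)
  case (pCons a p)
  have "M ** (M ** matpoly M p) = (M ** matpoly M p) ** M"
    by (metis pCons.IH matrix_mul_assoc)
  then show ?case
    by (simp add: matpoly_pCons matrix_add_ldistrib matrix_add_rdistrib mat_mult_commute)
qed (simp add: matrix_matrix_mult_def vec_eq_iff)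

text \<open>
  A linear factor may be split off on either side. Both orders are needed below: on the right the factor
  acts on the starting vector of an orbit, on the left it exhibits an eigenvector.
\<close>

lemma matpoly_linear_factor:
  "matpoly M ([:-\<mu>, 1:] * q) = (M - mat \<mu>) ** matpoly M q"
  "matpoly M ([:-\<mu>, 1:] * q) = matpoly M q ** (M - mat \<mu>)"
proof -
  have neg: "mat (-\<mu>) = - (mat \<mu> :: complex^'n^'n)" by (simp add: vec_eq_iff mat_def)
  have *: "matpoly M ([:-\<mu>, 1:] * q) = M ** matpoly M q - mat \<mu> ** matpoly M q"
    by (simp add: matpoly_add matpoly_smult matpoly_pCons mat_0 neg
       matrix_matrix_mult_def vec_eq_iff sum_negf del: smult_minus_left)
  show "matpoly M ([:-\<mu>, 1:] * q) = (M - mat \<mu>) ** matpoly M q"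
    unfolding * by (simp add: matrix_matrix_mult_def vec_eq_iff sum_subtractf algebra_simps)
  show "matpoly M ([:-\<mu>, 1:] * q) = matpoly M q ** (M - mat \<mu>)"
    unfolding * matpoly_commute mat_mult_commute[of \<mu>]
    by (simp add: matrix_matrix_mult_def vec_eq_iff sum_subtractf algebra_simps)
qed

text \<open>
  The powers of \<open>M\<close> live in a finite-dimensional space, so some power is a
  linear combination of lower ones. Real coefficients suffice for that, which is why the span over the
  reals can be used although the matrix is complex.
\<close>

lemma ex_annihilating_poly:
  fixes M :: "complex^'n^'n"
  shows "\<exists>p. p \<noteq> 0 \<and> matpoly M p = 0"
proof -
  let ?f = "\<lambda>k. matpoly M (monom 1 k)"
  obtain k where k: "?f k \<in> span (?f ` {..<k})"
    using ex_in_span_of_predecessors[of ?f] by blast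
  \<comment> \<open>The values of polynomials of degree less than \<open>k\<close>. They form a subspace that contains the first \<open>k\<close> powers, hence also the \<open>k\<close>-th.\<close>
  let ?V = "matpoly M ` {p. \<forall>j\<ge>k. coeff p j = 0}"
  have scale: "c *\<^sub>R matpoly M p = matpoly M (smult (of_real c) p)" for c p
    unfolding matpoly_smult
    by (simp add: vec_eq_iff matrix_matrix_mult_def mat_def mult_delta_left) (simp add: scaleR_conv_of_real)
  have "subspace ?V"
  proof (rule subspaceI)
    show "0 \<in> ?V" by (rule image_eqI[where x=0]) auto
  next
    fix x y assume "x \<in> ?V" "y \<in> ?V"
    then obtain p q where "x = matpoly M p" "y = matpoly M q"
        "\<forall>j\<ge>k. coeff p j = 0" "\<forall>j\<ge>k. coeff q j = 0" by auto
    then show "x + y \<in> ?V"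
      by (intro image_eqI[where x="p + q"]) (auto simp: matpoly_add)
  next
    fix c x assume "x \<in> ?V"
    then obtain p where "x = matpoly M p" "\<forall>j\<ge>k. coeff p j = 0" by auto
    then show "c *\<^sub>R x \<in> ?V"
      by (intro image_eqI[where x="smult (of_real c) p"]) (auto simp: scale)
  qed
  moreover have "?f ` {..<k} \<subseteq> ?V" by auto
  ultimately have "?f k \<in> ?V" using k span_minimal by blast
  then obtain p where p: "?f k = matpoly M p" "coeff p k = 0" by auto
  \<comment> \<open>The leading term of the relation cannot cancel.\<close>
  have "coeff (monom 1 k + smult (-1) p) k \<noteq> 0" using p by simp
  then have "monom 1 k + smult (-1) p \<noteq> 0" by (metis coeff_0)
  moreover have "matpoly M (monom 1 k + smult (-1) p) = 0"
    using scale[of "-1" p, symmetric] by (simp add: matpoly_add p(1) del: smult_minus_left)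
  ultimately show ?thesis by blast
qed

lemma matpoly_eigenvector:
  assumes "M *v v = \<mu> *s v"
  shows "matpoly M p *v v = poly p \<mu> *s v"
proof (induction p)
  case (pCons a p)
  then show ?case
    by (simp add: matpoly_pCons matrix_vector_mult_add_rdistrib mat_mult_vec assms vector_scalar_commute
        matrix_vector_mul_assoc[symmetric] vector_smult_assoc vector_sadd_rdistrib mult.commute)
qed simp

text \<open>
  Every eigenvalue is a root of an annihilating polynomial. Finiteness is what makes the maximum in the
  definition of the spectral radius a bound for all eigenvalues.
\<close>

lemma finite_complex_spectrum: "finite (complex_spectrum A)"
proof -
  obtain p where p: "p \<noteq> 0" "matpoly (map_matrix complex_of_real A) p = 0"
    using ex_annihilating_poly by blast
  have "complex_spectrum A \<subseteq> {z. poly p z = 0}"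
    unfolding complex_spectrum_def
    using matpoly_eigenvector[where p=p] p(2) by (force simp: vector_mul_eq_0)
  then show ?thesis using poly_roots_finite[OF p(1)] finite_subset by blast
qed

text \<open>
  With \<open>u k = f (Suc k) - \<mu> *s f k\<close>, the partial sums \<open>S\<close> of the norms satisfy
  \<open>S \<le> norm (f 0) + cmod \<mu> * S + (\<Sum>k. norm (u k))\<close>, which bounds \<open>S\<close>.
\<close>

lemma summable_of_contractive_recurrence:
  fixes f :: "nat \<Rightarrow> complex^'n"
  assumes "cmod \<mu> < 1" and "summable (\<lambda>k. norm (f (Suc k) - \<mu> *s f k))"
  shows "summable (\<lambda>k. norm (f k))"
proof (rule summableI_nonneg_bounded)
  let ?u = "\<lambda>k. norm (f (Suc k) - \<mu> *s f k)"
  have smul: "norm (\<mu> *s v) = cmod \<mu> * norm v" for v :: "complex^'n"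
    by (simp add: norm_vec_def norm_mult L2_set_right_distrib)
  fix n
  let ?S = "\<Sum>k<n. norm (f k)"
  have "?S \<le> (\<Sum>k<Suc n. norm (f k))" by simp
  also have "\<dots> = norm (f 0) + (\<Sum>k<n. norm (f (Suc k)))" by (rule sum.lessThan_Suc_shift)
  also have "(\<Sum>k<n. norm (f (Suc k))) \<le> (\<Sum>k<n. cmod \<mu> * norm (f k) + ?u k)"
    by (intro sum_mono) (metis smul norm_triangle_sub)
  also have "\<dots> = cmod \<mu> * ?S + (\<Sum>k<n. ?u k)"
    by (simp add: sum.distrib sum_distrib_left)
  also have "(\<Sum>k<n. ?u k) \<le> suminf ?u"
    by (rule sum_le_suminf[OF assms(2)]) auto
  finally have "(1 - cmod \<mu>) * ?S \<le> norm (f 0) + suminf ?u" by (simp add: algebra_simps)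
  then show "?S \<le> (norm (f 0) + suminf ?u) / (1 - cmod \<mu>)"
    using assms(1) by (simp add: field_simps)
qed auto

text \<open>
  Induction on the degree of a nonzero polynomial \<open>p\<close> with \<open>p(M) v = 0\<close>. Split off a linear factor with
  root \<open>\<mu>\<close>. If \<open>cmod \<mu> < 1\<close>, then the remaining factor annihilates \<open>M v - \<mu> v\<close>, whose orbit is summable
  by induction, and the orbit of \<open>v\<close> solves a contractive recurrence with this inhomogeneity. If
  \<open>cmod \<mu> \<ge> 1\<close>, then \<open>\<mu>\<close> is no eigenvalue, so the remaining factor already annihilates \<open>v\<close>.
\<close>

lemma summable_orbit:
  fixes M :: "complex^'n^'n"
  assumes ev: "\<And>\<mu> v. v \<noteq> 0 \<Longrightarrow> M *v v = \<mu> *s v \<Longrightarrow> cmod \<mu> < 1"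
  shows "summable (\<lambda>k. norm (((*v) M ^^ k) v))"
proof -
  have "p \<noteq> 0 \<Longrightarrow> matpoly M p *v v = 0 \<Longrightarrow> ?thesis" for p
  proof (induction "degree p" arbitrary: p v rule: less_induct)
    case less
    show ?case
    proof (cases "degree p = 0")
      case True
      then obtain a where a: "p = [:a:]" by (rule degree_eq_zeroE)
      with less.prems(1) have "a \<noteq> 0" by simp
      moreover have "matpoly M p = mat a"
        by (simp add: a matpoly_pCons)
      ultimately have "v = 0"
        using less.prems(2) by (simp add: mat_mult_vec)
      moreover have "((*v) M ^^ k) 0 = 0" for k by (induction k) auto
      ultimately show ?thesis by (simp only: norm_zero summable_zero)
    next
      case False
      then obtain \<mu> where "poly p \<mu> = 0"
        using fundamental_theorem_of_algebra[of p] by (auto simp: constant_degree)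
      then obtain q where q: "p = [:-\<mu>, 1:] * q" unfolding poly_eq_0_iff_dvd by (rule dvdE)
      with less.prems have q0: "q \<noteq> 0" by auto
      have deg: "degree q < degree p" using q0 unfolding q by (subst degree_mult_eq) auto
      have diff: "(M - mat \<mu>) *v y = M *v y - \<mu> *s y" for y
        by (simp add: matrix_vector_mult_diff_rdistrib mat_mult_vec)
      show ?thesis
      proof (cases "cmod \<mu> < 1")
        case True
        let ?u = "M *v v - \<mu> *s v"
        have "matpoly M q *v ?u = 0"
          using less.prems(2) unfolding q matpoly_linear_factor(2)
          by (simp add: matrix_vector_mul_assoc[symmetric] diff)
        from less.hyps[OF deg q0 this] have "summable (\<lambda>k. norm (((*v) M ^^ k) ?u))" .
        moreover have "((*v) M ^^ k) ?u = ((*v) M ^^ Suc k) v - \<mu> *s ((*v) M ^^ k) v" for k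
        proof (induction k)
          case (Suc k)
          have "((*v) M ^^ Suc k) ?u = M *v (((*v) M ^^ k) ?u)" by simp
          also have "\<dots> = M *v (((*v) M ^^ Suc k) v) - M *v (\<mu> *s ((*v) M ^^ k) v)"
            unfolding Suc.IH by (rule matrix_vector_mult_diff_distrib)
          also have "\<dots> = ((*v) M ^^ Suc (Suc k)) v - \<mu> *s ((*v) M ^^ Suc k) v"
            by (simp only: vector_scalar_commute funpow.simps o_apply)
          finally show ?case .
        qed simp
        ultimately have "summable (\<lambda>k. norm (((*v) M ^^ Suc k) v - \<mu> *s ((*v) M ^^ k) v))"
          by (simp only:)
        then show ?thesis by (rule summable_of_contractive_recurrence[OF True])
      next
        case False
        have "M *v (matpoly M q *v v) = \<mu> *s (matpoly M q *v v)"
          using less.prems(2) unfolding q matpoly_linear_factor(1)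
          by (simp add: matrix_vector_mul_assoc[symmetric] diff)
        with ev[of "matpoly M q *v v" \<mu>] False have "matpoly M q *v v = 0" by argo
        with less.hyps[OF deg q0] show ?thesis .
      qed
    qed
  qed
  moreover obtain p where "p \<noteq> 0" "matpoly M p = 0"
    using ex_annihilating_poly by blast
  ultimately show ?thesis by simp
qed

text \<open>
  The scaling factor \<open>c\<close> lets the hypothesis compare the spectral radius with a number other than one:
  the eigenvalues of \<open>c *\<^sub>R A\<close> are \<open>c\<close> times those of \<open>A\<close>.
\<close>

lemma summable_orbit_of_spectral_radius:
  fixes A :: "real^'n^'n"
  assumes c: "c > 0" and \<rho>: "mat_spectral_radius A < 1 / c"
  shows "summable (\<lambda>k. norm (((*v) (c *\<^sub>R A) ^^ k) v))"
proof -
  let ?emb = "\<lambda>v::real^'n. (\<chi> i. complex_of_real (v $ i))"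
  let ?M = "map_matrix complex_of_real (c *\<^sub>R A)"
  have "cmod \<mu> < 1" if "v \<noteq> 0" "?M *v v = \<mu> *s v" for \<mu> v
  proof -
    have M: "?M *v v = of_real c *s (map_matrix complex_of_real A *v v)"
      by (simp add: vec_eq_iff matrix_vector_mult_def map_matrix_def sum_distrib_left mult.assoc)
    have "map_matrix complex_of_real A *v v = inverse (of_real c) *s (?M *v v)"
      unfolding M using c by (simp add: vector_smult_assoc)
    also have "\<dots> = (\<mu> / of_real c) *s v"
      unfolding that(2) by (simp add: vector_smult_assoc divide_inverse mult.commute)
    finally have "\<mu> / of_real c \<in> complex_spectrum A"
      using that(1) unfolding complex_spectrum_def by auto
    then have "cmod (\<mu> / of_real c) \<le> mat_spectral_radius A"
      unfolding mat_spectral_radius_def by (intro Max_ge) (auto simp: finite_complex_spectrum)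
    with \<rho> c show ?thesis by (simp add: norm_divide field_simps)
  qed
  from summable_orbit[OF this] have "summable (\<lambda>k. norm (((*v) ?M ^^ k) (?emb v)))" .
  moreover have "((*v) ?M ^^ k) (?emb v) = ?emb (((*v) (c *\<^sub>R A) ^^ k) v)" for k
    by (induction k) (simp_all add: vec_eq_iff matrix_vector_mult_def map_matrix_def)
  moreover have "norm (?emb y) = norm y" for y
    by (simp add: norm_vec_def)
  ultimately show ?thesis by simp
qed

section \<open>A Lyapunov form as the sum of a series\<close>

text \<open>
  The \<open>k\<close>-th term of the series for the Lyapunov form. In terms of symmetric matrices this iterates
  \<open>P \<mapsto> \<Sum>i\<in>I. c i *\<^sub>R (transpose (A i) ** P ** A i)\<close>, starting from the identity.
\<close>

primrec transported_form ::
    "'i set \<Rightarrow> ('i \<Rightarrow> real) \<Rightarrow> ('i \<Rightarrow> real^'n^'n) \<Rightarrow> nat \<Rightarrow> real^'n \<Rightarrow> real^'n \<Rightarrow> real" where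
  "transported_form I c A 0 x y = x \<bullet> y"
| "transported_form I c A (Suc k) x y = (\<Sum>i\<in>I. c i * transported_form I c A k (A i *v x) (A i *v y))"

lemma transported_form_linear:
  "transported_form I c A k (x + x') y = transported_form I c A k x y + transported_form I c A k x' y"
  "transported_form I c A k x (y + y') = transported_form I c A k x y + transported_form I c A k x y'"
  "transported_form I c A k (r *\<^sub>R x) y = r * transported_form I c A k x y"
  "transported_form I c A k x (r *\<^sub>R y) = r * transported_form I c A k x y"
  by (induction k arbitrary: x x' y y')
    (simp_all add: inner_add_left inner_add_right matrix_vector_right_distrib sum.distrib
      distrib_left matrix_vector_mult_scaleR sum_distrib_left mult.left_commute)

lemma transported_form_nonneg:
  assumes "\<And>i. i \<in> I \<Longrightarrow> c i \<ge> 0"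
  shows "transported_form I c A k x x \<ge> 0"
  by (induction k arbitrary: x) (auto intro!: sum_nonneg mult_nonneg_nonneg assms)

text \<open>
  Transporting the whole series by one step only removes its first term, the inner product. This is
  the discrete Lyapunov equation. All terms are positive semidefinite, hence the sum
  dominates the first term.
\<close>

lemma ex_lyapunov_form:
  fixes A :: "'i \<Rightarrow> real^'n^'n"
  assumes c: "\<And>i. i \<in> I \<Longrightarrow> c i \<ge> 0"
    and summ: "\<And>x y. summable (\<lambda>k. transported_form I c A k x y)"
  obtains b where "bilinear b" and "\<And>x. x \<bullet> x \<le> b x x"
    and "\<And>x. (\<Sum>i\<in>I. c i * b (A i *v x) (A i *v x)) = b x x - x \<bullet> x"
proof
  let ?b = "\<lambda>x y. \<Sum>k. transported_form I c A k x y"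
  show "bilinear ?b"
    unfolding bilinear_def linear_iff
    by (simp add: transported_form_linear suminf_add suminf_mult summ)
  have "(\<Sum>i\<in>I. c i * ?b (A i *v x) (A i *v x)) = (\<Sum>i\<in>I. \<Sum>k. c i * transported_form I c A k (A i *v x) (A i *v x))" for x
    by (simp add: suminf_mult summ)
  also have "\<dots> x = (\<Sum>k. transported_form I c A (Suc k) x x)" for x
    by (simp add: suminf_sum summ summable_mult)
  finally show eq: "(\<Sum>i\<in>I. c i * ?b (A i *v x) (A i *v x)) = ?b x x - x \<bullet> x" for x
    using suminf_split_head[OF summ[of x x]] by simp
  have nonneg: "?b x x \<ge> 0" for x
    by (intro suminf_nonneg summ transported_form_nonneg c)
  show "x \<bullet> x \<le> ?b x x" for x
  proof -
    have "0 \<le> (\<Sum>i\<in>I. c i * ?b (A i *v x) (A i *v x))"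
      by (intro sum_nonneg mult_nonneg_nonneg c nonneg)
    then show ?thesis unfolding eq by simp
  qed
qed

definition kronecker_vec :: "real^'a \<Rightarrow> real^'b \<Rightarrow> real^('a \<times> 'b)" where
  "kronecker_vec x y = (\<chi> p. x $ fst p * y $ snd p)"

lemma kronecker_mult_kronecker_vec:
  "(A \<otimes>\<^sub>K B) *v kronecker_vec x y = kronecker_vec (A *v x) (B *v y)"
proof -
  have "(\<Sum>q\<in>UNIV. A $ a $ fst q * B $ b $ snd q * (x $ fst q * y $ snd q)) =
      (\<Sum>j\<in>UNIV. A $ a $ j * x $ j) * (\<Sum>l\<in>UNIV. B $ b $ l * y $ l)" for a b
    unfolding sum_product UNIV_Times_UNIV[symmetric] sum.cartesian_product
    by (intro sum.cong) (auto simp: mult_ac)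
  then show ?thesis
    by (simp add: vec_eq_iff kronecker_def kronecker_vec_def matrix_vector_mult_def)
qed

lemma linear_matrix_funpow: "linear ((*v) (M::real^'n^'n) ^^ k)"
proof (induction k)
  case (Suc k)
  show ?case
    unfolding funpow.simps by (rule linear_compose[OF Suc.IH matrix_vector_mul_linear])
qed (simp add: linear_iff)

text \<open>
  The Kronecker product of \<open>x\<close> and \<open>y\<close> has the entry \<open>x $ a * y $ d\<close> at \<open>(a, d)\<close>, so the inner product is
  the sum of its diagonal entries, and one step of the transport multiplies it by
  \<open>\<Sum>i\<in>I. c i *\<^sub>R (A i \<otimes>\<^sub>K A i)\<close>.
\<close>

lemma transported_form_eq_kronecker_power:
  fixes A :: "'i \<Rightarrow> real^'n^'n"
  shows "transported_form I c A k x y =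
      (\<Sum>a\<in>UNIV. ((*v) (\<Sum>i\<in>I. c i *\<^sub>R (A i \<otimes>\<^sub>K A i)) ^^ k) (kronecker_vec x y) $ (a, a))"
    (is "_ = (\<Sum>a\<in>UNIV. ((*v) ?M ^^ k) _ $ _)")
proof (induction k arbitrary: x y)
  case 0
  show ?case by (simp add: kronecker_vec_def inner_vec_def)
next
  case (Suc k)
  interpret linear "(*v) ?M ^^ k" by (rule linear_matrix_funpow)
  have sum_mult: "(\<Sum>i\<in>I. B i) *v v = (\<Sum>i\<in>I. B i *v v)" for B :: "'i \<Rightarrow> real^('n\<times>'n)^('n\<times>'n)" and v
    by (induction I rule: infinite_finite_induct) (simp_all add: matrix_vector_mult_add_rdistrib)
  have "?M *v kronecker_vec x y = (\<Sum>i\<in>I. c i *\<^sub>R kronecker_vec (A i *v x) (A i *v y))"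
    by (simp add: sum_mult scaleR_matrix_vector_assoc[symmetric] kronecker_mult_kronecker_vec)
  then have "((*v) ?M ^^ Suc k) (kronecker_vec x y) =
      (\<Sum>i\<in>I. c i *\<^sub>R ((*v) ?M ^^ k) (kronecker_vec (A i *v x) (A i *v y)))"
    by (simp only: funpow_Suc_right o_apply sum scale)
  then show ?case
    unfolding transported_form.simps Suc.IH
    by (simp only: sum_component vector_scaleR_component sum_distrib_left real_scaleR_def) (rule sum.swap)
qed

lemma summable_transported_form_kronecker:
  fixes A :: "'i \<Rightarrow> real^'n^'n"
  assumes "r > 0" and "mat_spectral_radius (\<Sum>i\<in>I. c i *\<^sub>R (A i \<otimes>\<^sub>K A i)) < 1 / r"
  shows "summable (\<lambda>k. transported_form I (\<lambda>i. r * c i) A k x y)"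
proof -
  let ?M = "\<Sum>i\<in>I. (r * c i) *\<^sub>R (A i \<otimes>\<^sub>K A i)"
  have M: "?M = r *\<^sub>R (\<Sum>i\<in>I. c i *\<^sub>R (A i \<otimes>\<^sub>K A i))"
    by (simp add: scaleR_sum_right)
  have "summable (\<lambda>k. norm (((*v) ?M ^^ k) (kronecker_vec x y)))"
    unfolding M by (rule summable_orbit_of_spectral_radius[OF assms])
  then have "summable (\<lambda>k. ((*v) ?M ^^ k) (kronecker_vec x y) $ p)" for p
    by (rule summable_comparison_test') (simp add: component_le_norm_cart)
  then show ?thesis
    unfolding transported_form_eq_kronecker_power by (intro summable_sum)
qed

lemma transported_form_singleton:
  shows "transported_form {j} (\<lambda>i. r\<^sup>2) A k x y =
    ((*v) (r *\<^sub>R A j) ^^ k) x \<bullet> ((*v) (r *\<^sub>R A j) ^^ k) y"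
proof (induction k arbitrary: x y)
  case (Suc k)
  interpret linear "(*v) (r *\<^sub>R A j) ^^ k" by (rule linear_matrix_funpow)
  have "((*v) (r *\<^sub>R A j) ^^ Suc k) z = r *\<^sub>R ((*v) (r *\<^sub>R A j) ^^ k) (A j *v z)" for z
    by (simp only: funpow_Suc_right o_apply scaleR_matrix_vector_assoc[symmetric] scale)
  then show ?case
    by (simp only: transported_form.simps Suc.IH inner_scaleR_left inner_scaleR_right) (simp add: power2_eq_square)
qed simp

text \<open>
  For a single matrix the terms are inner products of iterates. One of the iterates is bounded and the
  other one is summable.
\<close>

lemma summable_transported_form_singleton:
  fixes A :: "'i \<Rightarrow> real^'n^'n"
  assumes "r > 0" and "mat_spectral_radius (A j) < 1 / r"
  shows "summable (\<lambda>k. transported_form {j} (\<lambda>i. r\<^sup>2) A k x y)"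
proof -
  let ?f = "\<lambda>x k. ((*v) (r *\<^sub>R A j) ^^ k) x"
  have summ: "summable (\<lambda>k. norm (?f x k))" for x
    by (rule summable_orbit_of_spectral_radius[OF assms])
  obtain K where K: "\<And>k. norm (?f x k) \<le> K"
    using summable_imp_Bseq[OF summ[of x]] by (auto simp: Bseq_def)
  have "norm (?f x k \<bullet> ?f y k) \<le> K * norm (?f y k)" for k
    using Cauchy_Schwarz_ineq2[of "?f x k" "?f y k"] mult_right_mono[OF K[of k], of "norm (?f y k)"]
    by simp
  then have "summable (\<lambda>k. ?f x k \<bullet> ?f y k)"
    by (intro summable_comparison_test'[OF summable_mult[OF summ[of y]]]) auto
  then show ?thesis
    by (simp add: transported_form_singleton)
qed

section \<open>Quadratic forms and sliding windows under the integral\<close>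

text \<open>
  Summing \<open>0 \<le> b (y i - m) (y i - m)\<close>, where \<open>m\<close> is the mean of the \<open>y i\<close>, gives the inequality:
  both mixed terms equal \<open>card I * b m m\<close>, because the \<open>y i\<close> add up to \<open>card I *\<^sub>R m\<close>.
\<close>

lemma quadratic_form_sum_le:
  fixes b :: "'a::real_normed_vector \<Rightarrow> 'a \<Rightarrow> real"
  assumes b: "bounded_bilinear b" and pos: "\<And>x. 0 \<le> b x x"
  shows "b (\<Sum>i\<in>I. y i) (\<Sum>i\<in>I. y i) \<le> card I * (\<Sum>i\<in>I. b (y i) (y i))"
proof (cases "card I = 0")
  case True
  then have "(\<Sum>i\<in>I. y i) = 0" by (auto simp: card_eq_0_iff)
  then show ?thesis using True by (simp add: bounded_bilinear.zero_left[OF b])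
next
  case False
  interpret bounded_bilinear b by (rule b)
  let ?n = "real (card I)"
  define m where "m = (\<Sum>i\<in>I. y i) /\<^sub>R ?n"
  have s: "(\<Sum>i\<in>I. y i) = ?n *\<^sub>R m" using False by (simp add: m_def)
  have "0 \<le> (\<Sum>i\<in>I. b (y i - m) (y i - m))" by (intro sum_nonneg pos)
  also have "\<dots> = (\<Sum>i\<in>I. b (y i) (y i)) - b (\<Sum>i\<in>I. y i) m - b m (\<Sum>i\<in>I. y i) + ?n * b m m"
    by (simp add: diff_left diff_right sum_left sum_right sum_subtractf)
  also have "\<dots> = (\<Sum>i\<in>I. b (y i) (y i)) - ?n * b m m"
    unfolding s by (simp add: scaleR_left scaleR_right)
  finally have "?n * (?n * b m m) \<le> ?n * (\<Sum>i\<in>I. b (y i) (y i))"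
    by (intro mult_left_mono) auto
  then show ?thesis
    unfolding s by (simp add: scaleR_left scaleR_right)
qed

text \<open>
  The continuous counterpart, by the same variance argument.
\<close>

lemma quadratic_form_integral_le:
  fixes b :: "'a::euclidean_space \<Rightarrow> 'a \<Rightarrow> real" and f :: "real \<Rightarrow> 'a"
  assumes b: "bounded_bilinear b" and pos: "\<And>x. 0 \<le> b x x" and "u < v"
    and f: "f integrable_on {u..v}" and bf: "(\<lambda>s. b (f s) (f s)) integrable_on {u..v}"
  shows "b (integral {u..v} f) (integral {u..v} f) \<le> (v - u) * integral {u..v} (\<lambda>s. b (f s) (f s))"
proof -
  interpret bounded_bilinear b by (rule b)
  let ?y = "integral {u..v} f" and ?l = "v - u"
  define m where "m = ?y /\<^sub>R ?l"
  have s: "?y = ?l *\<^sub>R m" using \<open>u < v\<close> by (simp add: m_def)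
  have "((\<lambda>s. b (f s) m) has_integral b ?y m) {u..v}"
    using has_integral_linear[OF integrable_integral[OF f] bounded_linear_left[of m]] by (simp add: o_def)
  moreover have "((\<lambda>s. b m (f s)) has_integral b m ?y) {u..v}"
    using has_integral_linear[OF integrable_integral[OF f] bounded_linear_right[of m]] by (simp add: o_def)
  moreover have "((\<lambda>s. b m m) has_integral ?l * b m m) {u..v}"
    using has_integral_const_real[of "b m m" u v] \<open>u < v\<close> by simp
  ultimately have "((\<lambda>s. b (f s) (f s) - b (f s) m - b m (f s) + b m m) has_integral
      (integral {u..v} (\<lambda>s. b (f s) (f s)) - b ?y m - b m ?y + ?l * b m m)) {u..v}"
    by (intro has_integral_add has_integral_diff integrable_integral bf)
  moreover have "0 \<le> b (f s) (f s) - b (f s) m - b m (f s) + b m m" for s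
    using pos[of "f s - m"] by (simp add: diff_left diff_right)
  ultimately have "0 \<le> integral {u..v} (\<lambda>s. b (f s) (f s)) - b ?y m - b m ?y + ?l * b m m"
    by (rule has_integral_nonneg)
  also have "\<dots> = integral {u..v} (\<lambda>s. b (f s) (f s)) - ?l * b m m"
    unfolding s by (simp add: scaleR_left scaleR_right)
  finally have "?l * (?l * b m m) \<le> ?l * integral {u..v} (\<lambda>s. b (f s) (f s))"
    using \<open>u < v\<close> by (intro mult_left_mono) auto
  then show ?thesis
    unfolding s by (simp add: scaleR_left scaleR_right)
qed

text \<open>
  In terms of the primitive \<open>F\<close> of \<open>f\<close>, the window integral is \<open>F t - F (t - \<sigma>)\<close>. Its integral over
  \<open>[0, T]\<close> telescopes to the integral of \<open>F\<close> over \<open>[T - \<sigma>, T]\<close> minus that over \<open>[-\<sigma>, 0]\<close>. As \<open>F\<close>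
  is nonnegative and increasing, this is at most \<open>\<sigma> * F T\<close>. The primitive takes the place of
  an interchange of the order of integration.
\<close>

lemma sliding_window_integral:
  fixes f :: "real \<Rightarrow> real"
  assumes f: "f integrable_on {-h..T}" and nonneg: "\<And>s. 0 \<le> f s"
    and \<sigma>: "0 < \<sigma>" "\<sigma> \<le> h" and T: "0 \<le> T"
  shows "(\<lambda>t. integral {t - \<sigma>..t} f) integrable_on {0..T}"
    and "integral {0..T} (\<lambda>t. integral {t - \<sigma>..t} f) \<le> \<sigma> * integral {-h..T} f"
proof -
  define F where "F s = integral {-h..s} f" for s
  have int: "f integrable_on {a..d}" if "-h \<le> a" "d \<le> T" for a d
    by (rule integrable_on_subinterval[OF f]) (use that in auto)
  have cont: "continuous_on {-h..T} F"
    unfolding F_def by (rule indefinite_integral_continuous_1[OF f])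
  have Fint: "F integrable_on {a..d}" if "-h \<le> a" "d \<le> T" for a d
    by (intro integrable_continuous_real continuous_on_subset[OF cont]) (use that in auto)
  have F_nonneg: "0 \<le> F s" for s
    unfolding F_def by (cases "f integrable_on {-h..s}")
      (auto intro: Henstock_Kurzweil_Integration.integral_nonneg simp: nonneg not_integrable_integral)
  have F_le: "F s \<le> F T" if "s \<le> T" for s
    unfolding F_def using that by (intro integral_subset_le int) (auto simp: nonneg)
  have window: "integral {t - \<sigma>..t} f = F t - F (t - \<sigma>)" if "t \<in> {0..T}" for t
    using Henstock_Kurzweil_Integration.integral_combine[of "-h" "t - \<sigma>" t f] int[of "-h" t] that \<sigma>
    by (simp add: F_def)
  have shifted: "(\<lambda>t. F (t - \<sigma>)) integrable_on {0..T}"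
    using integrable_shift_real_ivl[OF Fint[of "-\<sigma>" "T - \<sigma>"], of "-\<sigma>"] \<sigma> by simp
  have "(\<lambda>t. F t - F (t - \<sigma>)) integrable_on {0..T}"
    using \<sigma> by (intro integrable_diff Fint shifted) auto
  then show "(\<lambda>t. integral {t - \<sigma>..t} f) integrable_on {0..T}"
    by (rule integrable_eq) (simp add: window)
  have "integral {0..T} (\<lambda>t. integral {t - \<sigma>..t} f) = integral {0..T} (\<lambda>t. F t - F (t - \<sigma>))"
    by (rule integral_cong) (rule window)
  also have "\<dots> = integral {0..T} F - integral {0..T} (\<lambda>t. F (t - \<sigma>))"
    using \<sigma> by (intro integral_diff Fint shifted) auto
  also have "integral {0..T} (\<lambda>t. F (t - \<sigma>)) = integral {-\<sigma>..T - \<sigma>} F"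
    using integral_shift_real_ivl[of "-\<sigma>" "-\<sigma>" "T - \<sigma>" F] by simp
  also have "integral {0..T} F - integral {-\<sigma>..T - \<sigma>} F = integral {T - \<sigma>..T} F - integral {-\<sigma>..0} F"
    using Henstock_Kurzweil_Integration.integral_combine[of "-\<sigma>" 0 T F]
      Henstock_Kurzweil_Integration.integral_combine[of "-\<sigma>" "T - \<sigma>" T F] Fint[of "-\<sigma>" T] \<sigma> T
    by simp
  also have "\<dots> \<le> integral {T - \<sigma>..T} F"
    using \<sigma> T by (simp add: Henstock_Kurzweil_Integration.integral_nonneg Fint F_nonneg)
  also have "\<dots> \<le> integral {T - \<sigma>..T} (\<lambda>_. F T)"
    using \<sigma> T by (intro integral_le Fint) (auto intro: F_le)
  also have "\<dots> = \<sigma> * integral {-h..T} f"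
    using \<sigma> by (simp add: F_def)
  finally show "integral {0..T} (\<lambda>t. integral {t - \<sigma>..t} f) \<le> \<sigma> * integral {-h..T} f" .
qed

section \<open>Regularity of solutions\<close>

lemma le_max_delay: "i \<in> {1..N} \<Longrightarrow> \<tau> i \<le> max_delay N \<tau>"
  unfolding max_delay_def by (intro Max_ge) auto

lemma ids_solution_windows:
  assumes sol: "ids_solution N A \<tau> \<phi> x" and "0 \<le> t"
  shows "i \<in> {1..N} \<Longrightarrow> x integrable_on {t - \<tau> i..t}"
    and "x t = (\<Sum>i=1..N. A i *v integral {t - \<tau> i..t} x)"
proof -
  have "(\<lambda>s. x (t + s)) integrable_on {- \<tau> i..0} \<longleftrightarrow> x integrable_on {t - \<tau> i..t}" for i
    using integrable_shift_real_ivl_iff[of x t "t - \<tau> i" t] by (simp add: add.commute)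
  moreover have "integral {- \<tau> i..0} (\<lambda>s. x (t + s)) = integral {t - \<tau> i..t} x" for i
    using integral_shift_real_ivl[of "t - \<tau> i" t t x] by (simp add: add.commute)
  moreover have "\<forall>i\<in>{1..N}. (\<lambda>s. x (t + s)) integrable_on {- \<tau> i..0}"
    and "x t = (\<Sum>i=1..N. A i *v integral {- \<tau> i..0} (\<lambda>s. x (t + s)))"
    using sol \<open>0 \<le> t\<close> unfolding ids_solution_def by blast+
  ultimately show "i \<in> {1..N} \<Longrightarrow> x integrable_on {t - \<tau> i..t}"
    and "x t = (\<Sum>i=1..N. A i *v integral {t - \<tau> i..t} x)"
    by (blast, simp only:)
qed

text \<open>
  The definition of a solution only speaks of windows \<open>[t - \<tau> i, t]\<close> with \<open>t \<ge> 0\<close>. For the longest delay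
  \<open>h\<close>, those that end at multiples of \<open>h\<close> cover the half-line.
\<close>

lemma ids_solution_integrable:
  assumes N: "N \<ge> 1" and pos: "\<And>i. i \<in> {1..N} \<Longrightarrow> \<tau> i > 0"
    and sol: "ids_solution N A \<tau> \<phi> x"
  shows "x integrable_on {- max_delay N \<tau>..T}"
proof -
  let ?h = "max_delay N \<tau>"
  have "?h \<in> \<tau> ` {1..N}" unfolding max_delay_def using N by (intro Max_in) auto
  then obtain j where j: "j \<in> {1..N}" "?h = \<tau> j" by blast
  have h: "?h > 0" using pos[OF j(1)] j(2) by simp
  have win: "x integrable_on {t - ?h..t}" if "0 \<le> t" for t
    unfolding j(2) by (rule ids_solution_windows(1)[OF sol that j(1)])
  have "x integrable_on {- ?h..real k * ?h}" for k
  proof (induction k)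
    case 0
    show ?case using win[of 0] by simp
  next
    case (Suc k)
    have "0 \<le> real k * ?h" using h by simp
    with h have le: "- ?h \<le> real k * ?h" by linarith
    show ?case
      using Henstock_Kurzweil_Integration.integrable_combine[OF le _ Suc.IH, of "real (Suc k) * ?h"]
        win[of "real (Suc k) * ?h"] h
      by (simp add: algebra_simps)
  qed
  moreover obtain k where "T < real k * ?h"
    using reals_Archimedean3[OF h] by blast
  ultimately show ?thesis
    using integrable_on_subinterval[of x "{- ?h..real k * ?h}" "- ?h" T] by auto
qed

text \<open>
  On \<open>[0, T]\<close> the solution is a linear image of differences of its own primitive.
\<close>

lemma ids_solution_continuous:
  assumes N: "N \<ge> 1" and pos: "\<And>i. i \<in> {1..N} \<Longrightarrow> \<tau> i > 0"
    and sol: "ids_solution N A \<tau> \<phi> x"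
  shows "continuous_on {0..T} x"
proof -
  let ?h = "max_delay N \<tau>"
  let ?F = "\<lambda>s. integral {-?h..s} x"
  note int = ids_solution_integrable[OF N pos sol]
  have F: "continuous_on {-?h..T} ?F"
    by (rule indefinite_integral_continuous_1[OF int])
  have cont: "continuous_on {0..T} (\<lambda>t. A i *v (?F t - ?F (t - \<tau> i)))" if "i \<in> {1..N}" for i
  proof -
    have h: "\<tau> i \<le> ?h" "0 < \<tau> i" using le_max_delay[OF that] pos[OF that] by auto
    have "continuous_on {0..T} ?F"
      by (rule continuous_on_subset[OF F]) (use h in auto)
    moreover have "continuous_on {0..T} (\<lambda>t. ?F (t - \<tau> i))"
      by (rule continuous_on_compose2[OF F]) (use h in \<open>auto intro!: continuous_intros\<close>)
    ultimately show ?thesis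
      by (intro bounded_linear.continuous_on[OF matrix_vector_mul_bounded_linear] continuous_on_diff)
  qed
  have eq: "x t = (\<Sum>i=1..N. A i *v (?F t - ?F (t - \<tau> i)))" if t: "t \<in> {0..T}" for t
  proof -
    have win: "integral {t - \<tau> i..t} x = ?F t - ?F (t - \<tau> i)" if "i \<in> {1..N}" for i
      using Henstock_Kurzweil_Integration.integral_combine[of "-?h" "t - \<tau> i" t x] int[of t]
        le_max_delay[OF that, of \<tau>] pos[OF that] t
      by (simp add: algebra_simps)
    have "x t = (\<Sum>i=1..N. A i *v integral {t - \<tau> i..t} x)"
      by (rule ids_solution_windows(2)[OF sol]) (use t in simp)
    also have "\<dots> = (\<Sum>i=1..N. A i *v (?F t - ?F (t - \<tau> i)))"
      by (intro sum.cong refl) (simp only: win)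
    finally show ?thesis .
  qed
  have "continuous_on {0..T} (\<lambda>t. \<Sum>i=1..N. A i *v (?F t - ?F (t - \<tau> i)))"
    by (intro continuous_on_sum cont)
  then show ?thesis
    by (rule continuous_on_eq) (rule eq[symmetric])
qed

text \<open>
  The solution may jump at \<open>0\<close> but is continuous on either side of it; on the left it agrees with
  \<open>\<phi>\<close> except possibly at the end point.
\<close>

lemma ids_solution_integrable_compose:
  assumes N: "N \<ge> 1" and pos: "\<And>i. i \<in> {1..N} \<Longrightarrow> \<tau> i > 0"
    and sol: "ids_solution N A \<tau> \<phi> x"
    and \<phi>: "continuous_on {- max_delay N \<tau>..0} \<phi>"
    and H: "continuous_on UNIV (\<lambda>z. H (fst z) (snd z) :: real)"
    and a: "- max_delay N \<tau> \<le> a"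
  shows "(\<lambda>u. H u (x u)) integrable_on {a..d}"
proof -
  let ?h = "max_delay N \<tau>"
  have comp: "continuous_on S (\<lambda>u. H u (y u))" if "continuous_on S y" for S and y :: "real \<Rightarrow> _"
    using continuous_on_compose2[OF H continuous_on_Pair[OF continuous_on_id that]] by simp
  have "1 \<in> {1..N}" using N by simp
  then have h: "?h > 0" using le_max_delay[of 1 N \<tau>] pos[of 1] by simp
  have "(\<lambda>u. H u (\<phi> u)) integrable_on {-?h..0}"
    by (intro integrable_continuous_real comp \<phi>)
  moreover have "H u (x u) = H u (\<phi> u)" if "u \<in> {-?h..0} - {0}" for u
    using sol that unfolding ids_solution_def by auto
  ultimately have "(\<lambda>u. H u (x u)) integrable_on {-?h..0}"
    by (intro integrable_spike_finite[of "{0}" "{-?h..0}" "\<lambda>u. H u (x u)" "\<lambda>u. H u (\<phi> u)"]) auto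
  moreover have "(\<lambda>u. H u (x u)) integrable_on {0..max 0 d}"
    by (intro integrable_continuous_real comp ids_solution_continuous[OF N pos sol])
  ultimately have "(\<lambda>u. H u (x u)) integrable_on {-?h..max 0 d}"
    using Henstock_Kurzweil_Integration.integrable_combine[of "-?h" 0 "max 0 d" "\<lambda>u. H u (x u)"] h by simp
  then show ?thesis
    by (rule integrable_on_subinterval) (use a in auto)
qed

section \<open>Exponential stability\<close>

text \<open>
  Write \<open>E u\<close> for the weight \<open>exp (2 * \<beta> * u)\<close>, \<open>h\<close> for the longest delay and \<open>w u\<close> for
  \<open>E u * b (x u) (x u)\<close>. The rate \<open>\<beta>\<close> is chosen so that the weight grows by the factor
  \<open>exp (\<delta> / 2)\<close> over the longest delay; then \<open>q = exp (\<delta> / 2) * (1 - \<delta>)\<close> is still less than one, and the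
  integral \<open>J\<close> of \<open>w\<close> over \<open>[-h, T]\<close> satisfies \<open>J \<le> J\<^sub>0 + q * J\<close>, where \<open>J\<^sub>0\<close> is the contribution of the
  initial function.
\<close>

lemma ids_exponentially_stable_of_lyapunov_form:
  fixes A :: "nat \<Rightarrow> real^'n^'n"
  assumes N: "N \<ge> 1" and pos: "\<And>i. i \<in> {1..N} \<Longrightarrow> \<tau> i > 0"
    and bil: "bilinear b" and dom: "\<And>x. x \<bullet> x \<le> b x x"
    and lyap: "\<And>x. (\<Sum>i=1..N. (real N * (\<tau> i)\<^sup>2) * b (A i *v x) (A i *v x)) = b x x - x \<bullet> x"
  shows "ids_exponentially_stable N A \<tau>"
proof -
  let ?h = "max_delay N \<tau>"
  have b: "bounded_bilinear b" using bil bilinear_conv_bounded_bilinear by blast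
  interpret bounded_bilinear b by (rule b)
  have b_nonneg: "0 \<le> b y y" for y using dom[of y] inner_ge_zero[of y] by linarith
  obtain B where "B > 0" and B: "\<And>x y. norm (b x y) \<le> B * norm x * norm y"
    using bilinear_bounded_pos[OF bil] by blast
  \<comment> \<open>The summand 1 ensures \<open>C > 1\<close>, hence \<open>\<delta> < 1\<close> below.\<close>
  define C where "C = 1 + B"
  have C: "C > 1" using \<open>B > 0\<close> by (simp add: C_def)
  have b_le: "b y y \<le> C * (norm y)\<^sup>2" for y
  proof -
    have "b y y \<le> B * (norm y)\<^sup>2" using B[of y y] by (simp add: power2_eq_square mult.assoc)
    also have "\<dots> \<le> C * (norm y)\<^sup>2" unfolding C_def by (intro mult_right_mono) auto
    finally show ?thesis .
  qed
  define \<delta> where "\<delta> = 1 / C"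
  have \<delta>: "0 < \<delta>" "\<delta> < 1" using C by (simp_all add: \<delta>_def)
  have "1 \<in> {1..N}" using N by simp
  then have h: "?h > 0" using le_max_delay[of 1 N \<tau>] pos[of 1] by simp
  define \<beta> where "\<beta> = \<delta> / (4 * ?h)"
  define q where "q = exp (\<delta> / 2) * (1 - \<delta>)"
  define K where "K = (\<Sum>i=1..N. 1 / \<tau> i)"
  define E where "E u = exp (2 * \<beta> * u)" for u
  have \<beta>: "\<beta> > 0" using \<delta> h by (simp add: \<beta>_def)
  have \<beta>h: "2 * \<beta> * ?h = \<delta> / 2" using h by (simp add: \<beta>_def)
  have q: "q < 1"
  proof -
    have "1 - \<delta> < exp (- (\<delta> / 2))" using exp_ge_add_one_self[of "- (\<delta> / 2)"] \<delta> by linarith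
    then have "q < exp (\<delta> / 2) * exp (- (\<delta> / 2))" unfolding q_def by (intro mult_strict_left_mono) auto
    then show ?thesis by (simp add: exp_minus)
  qed
  have q0: "0 < q" using \<delta> by (simp add: q_def)
  have K: "K > 0" unfolding K_def using N pos by (intro sum_pos) auto
  have E_pos: "E u > 0" for u by (simp add: E_def)
  define \<alpha> where "\<alpha> = sqrt (K * (?h * C / (1 - q)))"
  have \<alpha>: "\<alpha> > 0" using K h C q by (simp add: \<alpha>_def)
  have "norm (x t) \<le> \<alpha> * (SUP s\<in>{-?h..<0}. norm (\<phi> s)) * exp (- \<beta> * t)"
    if \<phi>: "continuous_on {-?h..0} \<phi>" and sol: "ids_solution N A \<tau> \<phi> x" and t: "0 \<le> t" for \<phi> x t
  proof -
    let ?M = "SUP s\<in>{-?h..<0}. norm (\<phi> s)"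
    have "bounded ((\<lambda>s. norm (\<phi> s)) ` {-?h..0})"
      by (intro compact_imp_bounded compact_continuous_image continuous_on_norm \<phi> compact_Icc)
    then have "bdd_above ((\<lambda>s. norm (\<phi> s)) ` {-?h..0})" by (rule bounded_imp_bdd_above)
    then have "bdd_above ((\<lambda>s. norm (\<phi> s)) ` {-?h..<0})" by (rule bdd_above_mono) auto
    then have M: "norm (\<phi> s) \<le> ?M" if "s \<in> {-?h..<0}" for s by (intro cSUP_upper that)
    have M0: "0 \<le> ?M" by (rule order_trans[OF norm_ge_zero M[of "-?h"]]) (use h in simp)
    define w where "w u = E u * b (x u) (x u)" for u
    define p where "p i u = E u * (real N * (\<tau> i)\<^sup>2 * b (A i *v x u) (A i *v x u))" for i u
    have w_nonneg: "0 \<le> w u" for u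
      unfolding w_def by (intro mult_nonneg_nonneg b_nonneg less_imp_le[OF E_pos])
    have p_nonneg: "0 \<le> p i u" for i u
      unfolding p_def by (intro mult_nonneg_nonneg b_nonneg less_imp_le[OF E_pos]) auto
    have sum_p: "(\<Sum>i=1..N. p i u) \<le> (1 - \<delta>) * w u" for u
    proof -
      have "\<delta> * b (x u) (x u) \<le> x u \<bullet> x u"
        using b_le[of "x u"] C by (simp add: \<delta>_def field_simps power2_norm_eq_inner)
      then have "(\<Sum>i=1..N. (real N * (\<tau> i)\<^sup>2) * b (A i *v x u) (A i *v x u)) \<le> (1 - \<delta>) * b (x u) (x u)"
        unfolding lyap by (simp add: algebra_simps)
      then have "E u * (\<Sum>i=1..N. (real N * (\<tau> i)\<^sup>2) * b (A i *v x u) (A i *v x u))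
          \<le> E u * ((1 - \<delta>) * b (x u) (x u))"
        by (intro mult_left_mono less_imp_le[OF E_pos])
      then show ?thesis unfolding p_def w_def by (simp add: sum_distrib_left mult_ac)
    qed
    note int_compose = ids_solution_integrable_compose[OF N pos sol \<phi>]
    have cont_form: "continuous_on UNIV (\<lambda>z. b (L (snd z)) (L (snd z)))"
      if "bounded_linear L" for L :: "real^'n \<Rightarrow> real^'n"
      by (intro continuous_on bounded_linear.continuous_on[OF that] continuous_on_snd continuous_on_id)
    have w_int: "w integrable_on {a..d}" if "-?h \<le> a" for a d
      unfolding w_def E_def
      by (intro int_compose[where H="\<lambda>u y. exp (2 * \<beta> * u) * b y y"] that continuous_on_mult
          cont_form[of "\<lambda>y. y"] bounded_linear_ident continuous_on_exp continuous_on_mult_left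
          continuous_on_fst continuous_on_id)
    have p_int: "p i integrable_on {a..d}" if "-?h \<le> a" for i a d
      unfolding p_def E_def
      by (intro int_compose[where H="\<lambda>u y. exp (2 * \<beta> * u) * (real N * (\<tau> i)\<^sup>2 * b (A i *v y) (A i *v y))"]
          that continuous_on_mult cont_form[of "(*v) (A i)"] matrix_vector_mul_bounded_linear
          continuous_on_exp continuous_on_mult_left continuous_on_fst continuous_on_id)
    have form_int: "(\<lambda>u. b (A i *v x u) (A i *v x u)) integrable_on {a..d}" if "-?h \<le> a" for i a d
      by (intro int_compose[where H="\<lambda>u y. b (A i *v y) (A i *v y)"]
          that cont_form[of "(*v) (A i)"] matrix_vector_mul_bounded_linear)
    \<comment> \<open>The window inequality at time \<open>t\<close>. Moving the weight from \<open>t\<close> to \<open>u \<in> {t - \<tau> i..t}\<close> costs at most the factor \<open>exp (\<delta> / 2)\<close>.\<close>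
    have window: "w t \<le> exp (\<delta> / 2) * (\<Sum>i=1..N. 1 / \<tau> i * integral {t - \<tau> i..t} (p i))"
      if t: "0 \<le> t" for t
    proof -
      let ?y = "\<lambda>i. A i *v integral {t - \<tau> i..t} x"
      have "b (x t) (x t) \<le> real N * (\<Sum>i=1..N. b (?y i) (?y i))"
        using quadratic_form_sum_le[OF b b_nonneg, of ?y "{1..N}"]
        unfolding ids_solution_windows(2)[OF sol t, symmetric] by simp
      also have "\<dots> = (\<Sum>i=1..N. real N * b (?y i) (?y i))" by (rule sum_distrib_left)
      finally have "w t \<le> E t * (\<Sum>i=1..N. real N * b (?y i) (?y i))"
        unfolding w_def by (intro mult_left_mono less_imp_le[OF E_pos])
      also have "\<dots> = (\<Sum>i=1..N. E t * (real N * b (?y i) (?y i)))" by (rule sum_distrib_left)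
      also have "\<dots> \<le> (\<Sum>i=1..N. exp (\<delta> / 2) * (1 / \<tau> i * integral {t - \<tau> i..t} (p i)))"
      proof (rule sum_mono)
        fix i assume i: "i \<in> {1..N}"
        have \<tau>: "0 < \<tau> i" "\<tau> i \<le> ?h" using pos[OF i] le_max_delay[OF i] by auto
        let ?f = "\<lambda>u. b (A i *v x u) (A i *v x u)"
        have x_int: "x integrable_on {t - \<tau> i..t}" by (rule ids_solution_windows(1)[OF sol t i])
        have y: "?y i = integral {t - \<tau> i..t} (\<lambda>u. A i *v x u)"
          using integral_linear[OF x_int matrix_vector_mul_bounded_linear[of "A i"]] by (simp add: o_def)
        have Ax_int: "(\<lambda>u. A i *v x u) integrable_on {t - \<tau> i..t}"
          using integrable_linear[OF x_int matrix_vector_mul_bounded_linear[of "A i"]] by (simp add: o_def)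
        have f_int: "?f integrable_on {t - \<tau> i..t}" using \<tau> t by (intro form_int) auto
        have "b (?y i) (?y i) \<le> \<tau> i * integral {t - \<tau> i..t} ?f"
          unfolding y using quadratic_form_integral_le[OF b b_nonneg _ Ax_int f_int] \<tau> by simp
        then have "E t * (real N * b (?y i) (?y i)) \<le> E t * (real N * (\<tau> i * integral {t - \<tau> i..t} ?f))"
          by (intro mult_left_mono less_imp_le[OF E_pos]) auto
        also have "\<dots> = 1 / \<tau> i * (E t * (real N * (\<tau> i)\<^sup>2 * integral {t - \<tau> i..t} ?f))"
          using \<tau> by (simp add: power2_eq_square)
        also have "\<dots> = 1 / \<tau> i * integral {t - \<tau> i..t} (\<lambda>u. E t * (real N * (\<tau> i)\<^sup>2 * ?f u))"
          by simp
        also have "\<dots> \<le> 1 / \<tau> i * integral {t - \<tau> i..t} (\<lambda>u. exp (\<delta> / 2) * p i u)"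
        proof (intro mult_left_mono integral_le)
          show "(\<lambda>u. E t * (real N * (\<tau> i)\<^sup>2 * ?f u)) integrable_on {t - \<tau> i..t}"
            using f_int by (intro integrable_on_mult_right)
          show "(\<lambda>u. exp (\<delta> / 2) * p i u) integrable_on {t - \<tau> i..t}"
            using \<tau> t by (intro integrable_on_mult_right p_int) auto
          fix u assume u: "u \<in> {t - \<tau> i..t}"
          have "\<beta> * (t - u) \<le> \<beta> * ?h" using u \<tau> \<beta> by (intro mult_left_mono) auto
          then have "2 * \<beta> * t \<le> \<delta> / 2 + 2 * \<beta> * u" using \<beta>h by (simp add: algebra_simps)
          then have "E t \<le> exp (\<delta> / 2) * E u" unfolding E_def exp_add[symmetric] by simp
          then show "E t * (real N * (\<tau> i)\<^sup>2 * ?f u) \<le> exp (\<delta> / 2) * p i u"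
            unfolding p_def mult.assoc[symmetric] by (intro mult_right_mono b_nonneg) auto
        qed (use \<tau> in simp)
        also have "\<dots> = exp (\<delta> / 2) * (1 / \<tau> i * integral {t - \<tau> i..t} (p i))" by simp
        finally show "E t * (real N * b (?y i) (?y i)) \<le> exp (\<delta> / 2) * (1 / \<tau> i * integral {t - \<tau> i..t} (p i))" .
      qed
      finally show ?thesis by (simp only: sum_distrib_left)
    qed
    have sum_p_integral: "exp (\<delta> / 2) * (\<Sum>i=1..N. integral {-?h..T} (p i)) \<le> q * integral {-?h..T} w" for T
    proof -
      have "(\<Sum>i=1..N. integral {-?h..T} (p i)) = integral {-?h..T} (\<lambda>u. \<Sum>i=1..N. p i u)"
        by (intro integral_sum[symmetric] p_int) auto
      also have "\<dots> \<le> integral {-?h..T} (\<lambda>u. (1 - \<delta>) * w u)"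
        by (intro integral_le integrable_sum integrable_on_mult_right p_int w_int sum_p) auto
      finally have "exp (\<delta> / 2) * (\<Sum>i=1..N. integral {-?h..T} (p i)) \<le> exp (\<delta> / 2) * ((1 - \<delta>) * integral {-?h..T} w)"
        by (intro mult_left_mono) auto
      then show ?thesis by (simp add: q_def mult.assoc)
    qed
    \<comment> \<open>The initial data bound \<open>x\<close> on \<open>[-h, 0)\<close> only; the point \<open>0\<close>, where \<open>x\<close> may jump, is excluded as a null set.\<close>
    have past: "integral {-?h..0} w \<le> ?h * C * ?M\<^sup>2"
    proof -
      have "norm (w u) \<le> C * ?M\<^sup>2" if u: "u \<in> cbox (-?h) 0 - {0}" for u
      proof -
        have "x u = \<phi> u" using sol u unfolding ids_solution_def by auto
        then have "(norm (x u))\<^sup>2 \<le> ?M\<^sup>2" using M[of u] u by (intro power_mono) auto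
        then have "b (x u) (x u) \<le> C * ?M\<^sup>2"
          using b_le[of "x u"] mult_left_mono[of "(norm (x u))\<^sup>2" "?M\<^sup>2" C] C by linarith
        moreover have "E u \<le> 1" unfolding E_def using u \<beta> by (simp add: mult_nonneg_nonpos)
        ultimately have "w u \<le> 1 * (C * ?M\<^sup>2)"
          unfolding w_def by (intro mult_mono b_nonneg) auto
        then show ?thesis using w_nonneg[of u] by simp
      qed
      moreover have "(w has_integral integral {-?h..0} w) (cbox (-?h) 0)"
        using w_int[of "-?h" 0] by (simp add: integrable_integral)
      ultimately have "norm (integral {-?h..0} w) \<le> C * ?M\<^sup>2 * measure lborel (cbox (-?h) 0)"
        using C by (intro has_integral_bound_spike_finite[where S="{0}"]) auto
      then show ?thesis using h by (simp add: mult_ac)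
    qed
    \<comment> \<open>Integrating the window inequality over \<open>[0, T]\<close> and absorbing the term \<open>q * J\<close>.\<close>
    have total: "integral {-?h..T} w \<le> ?h * C * ?M\<^sup>2 / (1 - q)" if T: "0 \<le> T" for T
    proof -
      have sw: "(\<lambda>t. integral {t - \<tau> i..t} (p i)) integrable_on {0..T}"
        "integral {0..T} (\<lambda>t. integral {t - \<tau> i..t} (p i)) \<le> \<tau> i * integral {-?h..T} (p i)"
        if "i \<in> {1..N}" for i
        using sliding_window_integral[OF p_int[of "-?h" i T] p_nonneg pos[OF that] le_max_delay[OF that] T]
        by simp_all
      have "integral {0..T} w \<le> integral {0..T} (\<lambda>t. exp (\<delta> / 2) * (\<Sum>i=1..N. 1 / \<tau> i * integral {t - \<tau> i..t} (p i)))"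
        using h by (intro integral_le w_int integrable_on_mult_right integrable_sum sw(1) window) auto
      also have "\<dots> = exp (\<delta> / 2) * (\<Sum>i=1..N. 1 / \<tau> i * integral {0..T} (\<lambda>t. integral {t - \<tau> i..t} (p i)))"
        by (simp only: integral_mult_right
            integral_sum[OF finite_atLeastAtMost integrable_on_mult_right[OF sw(1)]])
      also have "\<dots> \<le> exp (\<delta> / 2) * (\<Sum>i=1..N. integral {-?h..T} (p i))"
      proof (intro mult_left_mono sum_mono)
        fix i assume i: "i \<in> {1..N}"
        show "1 / \<tau> i * integral {0..T} (\<lambda>t. integral {t - \<tau> i..t} (p i)) \<le> integral {-?h..T} (p i)"
          using sw(2)[OF i] pos[OF i] by (simp add: field_simps)
      qed simp
      also have "\<dots> \<le> q * integral {-?h..T} w" by (rule sum_p_integral)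
      finally have "integral {0..T} w \<le> q * integral {-?h..T} w" .
      moreover have "integral {-?h..0} w + integral {0..T} w = integral {-?h..T} w"
        using h T by (intro Henstock_Kurzweil_Integration.integral_combine w_int) auto
      ultimately have "(1 - q) * integral {-?h..T} w \<le> ?h * C * ?M\<^sup>2"
        using past by (simp add: algebra_simps)
      then show ?thesis using q by (simp add: field_simps)
    qed
    \<comment> \<open>The window inequality once more, now to bound the value at \<open>t\<close> by the integral up to \<open>t\<close>.\<close>
    have "w t \<le> exp (\<delta> / 2) * (\<Sum>i=1..N. 1 / \<tau> i * integral {t - \<tau> i..t} (p i))"
      by (rule window[OF t])
    also have "\<dots> \<le> exp (\<delta> / 2) * (\<Sum>i=1..N. K * integral {-?h..t} (p i))"
    proof (intro mult_left_mono sum_mono)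
      fix i assume i: "i \<in> {1..N}"
      have \<tau>: "0 < \<tau> i" "\<tau> i \<le> ?h" using pos[OF i] le_max_delay[OF i] by auto
      have "1 / \<tau> i \<le> K"
        unfolding K_def using i pos by (intro member_le_sum) (auto intro: less_imp_le)
      moreover have "integral {t - \<tau> i..t} (p i) \<le> integral {-?h..t} (p i)"
        using \<tau> t by (intro integral_subset_le p_int) (auto simp: p_nonneg)
      moreover have "0 \<le> integral {t - \<tau> i..t} (p i)"
        using \<tau> t by (intro Henstock_Kurzweil_Integration.integral_nonneg p_int) (auto simp: p_nonneg)
      ultimately show "1 / \<tau> i * integral {t - \<tau> i..t} (p i) \<le> K * integral {-?h..t} (p i)"
        using K by (intro mult_mono) auto
    qed simp
    also have "\<dots> = K * (exp (\<delta> / 2) * (\<Sum>i=1..N. integral {-?h..t} (p i)))"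
      by (simp add: sum_distrib_left mult_ac)
    also have "\<dots> \<le> K * (q * integral {-?h..t} w)"
      using K by (intro mult_left_mono sum_p_integral) auto
    also have "\<dots> \<le> K * (1 * (?h * C * ?M\<^sup>2 / (1 - q)))"
    proof (intro mult_left_mono mult_mono total[OF t])
      show "0 \<le> integral {-?h..t} w"
        by (intro Henstock_Kurzweil_Integration.integral_nonneg w_int) (simp_all add: w_nonneg)
    qed (use K q in simp_all)
    also have "\<dots> = \<alpha>\<^sup>2 * ?M\<^sup>2"
      using K h C q by (simp add: \<alpha>_def)
    finally have "w t \<le> \<alpha>\<^sup>2 * ?M\<^sup>2" .
    moreover have "E t * (norm (x t))\<^sup>2 \<le> w t"
      unfolding w_def using dom[of "x t"] by (intro mult_left_mono less_imp_le[OF E_pos]) (simp add: power2_norm_eq_inner)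
    ultimately have "exp (- (2 * \<beta> * t)) * (E t * (norm (x t))\<^sup>2) \<le> exp (- (2 * \<beta> * t)) * (\<alpha>\<^sup>2 * ?M\<^sup>2)"
      by (intro mult_left_mono) auto
    moreover have "exp (- (2 * \<beta> * t)) * (E t * (norm (x t))\<^sup>2) = (norm (x t))\<^sup>2"
      unfolding E_def mult.assoc[symmetric] exp_add[symmetric] by simp
    moreover have "exp (- (2 * \<beta> * t)) * (\<alpha>\<^sup>2 * ?M\<^sup>2) = (\<alpha> * ?M * exp (- \<beta> * t))\<^sup>2"
      by (simp add: power_mult_distrib exp_double[symmetric] mult_ac)
    ultimately have "(norm (x t))\<^sup>2 \<le> (\<alpha> * ?M * exp (- \<beta> * t))\<^sup>2" by simp
    then show ?thesis
      by (rule power2_le_imp_le) (use \<alpha> M0 in simp)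
  qed
  with \<alpha> \<beta> show ?thesis unfolding ids_exponentially_stable_def by blast
qed

theorem corollary2:
  fixes N :: nat and A :: "nat \<Rightarrow> real^'n^'n" and \<tau> :: "nat \<Rightarrow> real"
  assumes "N \<ge> 1"
    and "\<And>i. i \<in> {1..N} \<Longrightarrow> \<tau> i > 0"
  shows "(mat_spectral_radius (\<Sum>i=1..N. (\<tau> i)\<^sup>2 *\<^sub>R (A i \<otimes>\<^sub>K A i)) < 1 / real N
            \<longrightarrow> ids_exponentially_stable N A \<tau>) \<and>
         (N = 1 \<longrightarrow> mat_spectral_radius (A 1) < 1 / \<tau> 1
            \<longrightarrow> ids_exponentially_stable N A \<tau>)"
proof -
  have stable: "ids_exponentially_stable N A \<tau>"
    if "\<And>x y. summable (\<lambda>k. transported_form {1..N} (\<lambda>i. real N * (\<tau> i)\<^sup>2) A k x y)"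
  proof -
    show ?thesis
    proof (rule ex_lyapunov_form[OF _ that])
      fix b :: "real^'n \<Rightarrow> real^'n \<Rightarrow> real"
      assume "bilinear b" "\<And>x. x \<bullet> x \<le> b x x"
        "\<And>x. (\<Sum>i=1..N. (real N * (\<tau> i)\<^sup>2) * b (A i *v x) (A i *v x)) = b x x - x \<bullet> x"
      with assms show ?thesis by (rule ids_exponentially_stable_of_lyapunov_form)
    qed simp
  qed
  show ?thesis
  proof (intro conjI impI)
    assume "mat_spectral_radius (\<Sum>i=1..N. (\<tau> i)\<^sup>2 *\<^sub>R (A i \<otimes>\<^sub>K A i)) < 1 / real N"
    then show "ids_exponentially_stable N A \<tau>"
      using assms(1) by (intro stable summable_transported_form_kronecker) auto
  next
    assume 1: "N = 1" and \<rho>: "mat_spectral_radius (A 1) < 1 / \<tau> 1"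
    have "\<tau> 1 > 0" using assms(2)[of 1] 1 by simp
    have eq: "transported_form {1..N} (\<lambda>i. real N * (\<tau> i)\<^sup>2) A = transported_form {1} (\<lambda>i. (\<tau> 1)\<^sup>2) A"
    proof (intro ext)
      show "transported_form {1..N} (\<lambda>i. real N * (\<tau> i)\<^sup>2) A k x y = transported_form {1} (\<lambda>i. (\<tau> 1)\<^sup>2) A k x y" for k x y
        by (induction k arbitrary: x y) (simp_all add: 1)
    qed
    show "ids_exponentially_stable N A \<tau>"
      by (rule stable) (simp only: eq summable_transported_form_singleton[where A=A and j=1, OF \<open>\<tau> 1 > 0\<close> \<rho>])
  qed
qed

end
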